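(* Let $P$ be any linear relaxation of the CFL (metric capacitated facility location) polytope for the family of instances $I(3n,n^4+1,U,1)$ that uses the classic variables $(y,x)$ and has size $2^{o(n)}$. There is a constant $c>0$ such that for all $t\le cn$ the integrality gap of $\operatorname{SA}^t(P)$ is $\Omega(n)$.
   Context: Instances. $I(3n,n^4+1,U,1)$ has a set $F$ of $3n$ facilities, a set $C$ of $m=n^4+1$ clients of unit demand, and uniform capacity $U$ with $(n^4+1)-nU=2^{-n^2}$. The classic variables are $y_i$ ($i\in F$, facility opening, integer) and $x_{ij}$ ($i\in F,j\in C$, fraction of demand of $j$ assigned to $i$, fractional). The mixed integer feasible solutions are $(y,x)\in\{0,1\}^{3n}\times[0,1]^{3nm}$ with $\sum_i x_{ij}=1$ for all $j$, $0\le x_{ij}\le y_i$, and $\sum_j x_{ij}\le Uy_i$; the CFL polytope is their convex hull. Admissible objectives (to minimize) are $\sum_i f_iy_i+\sum_{i,j}c_{ij}x_{ij}$ with $f_i,c_{ij}\ge0$ and $c_{ij}\le c_{i'j}+c_{i'j'}+c_{ij'}$ for all $i,i',j,j'$. A linear relaxation (for the family) is, for each $n$, a polyhedron $P$ in the space of the variables $(y,x)$ that contains the CFL polytope and, as required for the Sherali-Adams procedure, has the same points with $y\in\{0,1\}^{3n}$, $x\in[0,1]^{3nm}$ as the CFL polytope. Its size is the minimum number of inequalities in a halfspace description. Its integrality gap is the supremum, over admissible objectives, of the ratio of the optimal mixed integer cost to the optimal cost over the relaxation. Sherali-Adams at level $t\ge1$: for every linear constraint $\pi(y,x)\le0$ in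 the description of $P$, every set $A\subseteq\{y_i\mid i\in F\}$ with $|A|\le t$, and every $W\subseteq A$, consider the lifted constraint $\pi(y,x)\prod_{y_i\in A-W}y_i\prod_{y_i\in W}(1-y_i)\le0$. Linearize by replacing each $y_i^2$ by $y_i$, each product $\prod_{i\in S}y_i$ by a new variable $y_S$, and each product $x_{ij}\prod_{i'\in S}y_{i'}$ by a new variable $v_{S,ij}$. $\operatorname{SA}^t(P)$ is the projection of the resulting linear system onto the original variables $(y,x)$. *)

theory Defs
  imports "HOL-Analysis.Analysis" "HOL-Analysis.Finite_Function_Topology" "HOL-Library.Landau_Symbols"
begin

text \<open>
  The dimension of the ambient space varies with \<open>n\<close>, so points of all the spaces live in one type
  of finitely supported vectors indexed by variables; \<open>space_of n\<close> is the space belonging to the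
  \<open>n\<close>-th instance. Facilities and clients are numbered from 0.
\<close>

datatype var = Yvar nat | Xvar nat nat

type_synonym point = "(var, real) poly_mapping"

abbreviation yval :: "point \<Rightarrow> nat \<Rightarrow> real" where
  "yval z i \<equiv> Poly_Mapping.lookup z (Yvar i)"

abbreviation xval :: "point \<Rightarrow> nat \<Rightarrow> nat \<Rightarrow> real" where
  "xval z i j \<equiv> Poly_Mapping.lookup z (Xvar i j)"

definition facilities :: "nat \<Rightarrow> nat set" where
  "facilities n = {..<3 * n}"

definition clients :: "nat \<Rightarrow> nat set" where
  "clients n = {..<n ^ 4 + 1}"

definition variables :: "nat \<Rightarrow> var set" where
  "variables n = Yvar ` facilities n \<union> (\<lambda>(i, j). Xvar i j) ` (facilities n \<times> clients n)"

definition space_of :: "nat \<Rightarrow> point set" where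
  "space_of n = {z. Poly_Mapping.keys z \<subseteq> variables n}"

text \<open>The capacity \<open>U\<close> is the solution of \<open>(n^4 + 1) - n U = 2^(-n^2)\<close>, for \<open>n \<ge> 1\<close>.\<close>

definition capacity :: "nat \<Rightarrow> real" where
  "capacity n = (real (n ^ 4 + 1) - 2 powr (- real (n ^ 2))) / real n"

lemma capacity_eq:
  assumes "n \<ge> 1"
  shows "real (n ^ 4 + 1) - real n * capacity n = 2 powr (- real (n ^ 2))"
  using assms by (simp add: capacity_def)

definition mixed_integral :: "nat \<Rightarrow> point \<Rightarrow> bool" where
  "mixed_integral n z \<longleftrightarrow>
     (\<forall>i\<in>facilities n. yval z i \<in> {0, 1}) \<and>
     (\<forall>i\<in>facilities n. \<forall>j\<in>clients n. xval z i j \<in> {0..1})"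

definition mixed_integer_solutions :: "nat \<Rightarrow> point set" where
  "mixed_integer_solutions n = {z \<in> space_of n. mixed_integral n z \<and>
     (\<forall>j\<in>clients n. (\<Sum>i\<in>facilities n. xval z i j) = 1) \<and>
     (\<forall>i\<in>facilities n. \<forall>j\<in>clients n. 0 \<le> xval z i j \<and> xval z i j \<le> yval z i) \<and>
     (\<forall>i\<in>facilities n. (\<Sum>j\<in>clients n. xval z i j) \<le> capacity n * yval z i)}"

definition cfl_polytope :: "nat \<Rightarrow> point set" where
  "cfl_polytope n = convex hull (mixed_integer_solutions n)"

text \<open>A pair \<open>(a, b)\<close> stands for the inequality \<open>a \<cdot> z \<le> b\<close>, that is, \<open>\<pi>(y, x) = a \<cdot> z - b \<le> 0\<close>;
  coefficients of variables outside \<open>variables n\<close> are ignored.\<close>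

type_synonym inequality = "(var \<Rightarrow> real) \<times> real"

definition solution_set :: "nat \<Rightarrow> inequality set \<Rightarrow> point set" where
  "solution_set n D =
     {z \<in> space_of n. \<forall>(a, b)\<in>D. (\<Sum>v\<in>variables n. a v * Poly_Mapping.lookup z v) \<le> b}"

definition halfspace_description :: "nat \<Rightarrow> inequality set \<Rightarrow> point set \<Rightarrow> bool" where
  "halfspace_description n D P \<longleftrightarrow> finite D \<and> solution_set n D = P"

definition linear_relaxation :: "nat \<Rightarrow> point set \<Rightarrow> bool" where
  "linear_relaxation n P \<longleftrightarrow>
     (\<exists>D. halfspace_description n D P) \<and>
     cfl_polytope n \<subseteq> P \<and>
     {z \<in> P. mixed_integral n z} = {z \<in> cfl_polytope n. mixed_integral n z}"

definition relaxation_size :: "nat \<Rightarrow> point set \<Rightarrow> nat" where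
  "relaxation_size n P = (LEAST k. \<exists>D. halfspace_description n D P \<and> card D = k)"

definition admissible_objective :: "nat \<Rightarrow> (nat \<Rightarrow> real) \<Rightarrow> (nat \<Rightarrow> nat \<Rightarrow> real) \<Rightarrow> bool" where
  "admissible_objective n f c \<longleftrightarrow>
     (\<forall>i\<in>facilities n. 0 \<le> f i) \<and>
     (\<forall>i\<in>facilities n. \<forall>j\<in>clients n. 0 \<le> c i j) \<and>
     (\<forall>i\<in>facilities n. \<forall>i'\<in>facilities n. \<forall>j\<in>clients n. \<forall>j'\<in>clients n.
        c i j \<le> c i' j + c i' j' + c i j')"

definition cost :: "nat \<Rightarrow> (nat \<Rightarrow> real) \<Rightarrow> (nat \<Rightarrow> nat \<Rightarrow> real) \<Rightarrow> point \<Rightarrow> real" where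
  "cost n f c z = (\<Sum>i\<in>facilities n. f i * yval z i) +
     (\<Sum>i\<in>facilities n. \<Sum>j\<in>clients n. c i j * xval z i j)"

definition optimal_cost :: "nat \<Rightarrow> (nat \<Rightarrow> real) \<Rightarrow> (nat \<Rightarrow> nat \<Rightarrow> real) \<Rightarrow> point set \<Rightarrow> ereal" where
  "optimal_cost n f c S = (INF z\<in>S. ereal (cost n f c z))"

text \<open>
  A relaxation is not required to lie in the nonnegative orthant, so its optimal cost may be zero,
  negative or \<open>-\<infinity>\<close>. The ratio is then read as \<open>\<infinity>\<close> if the mixed integer optimum is positive and
  as 0 if it is zero (\<open>a / 0 = \<infinity>\<close> for \<open>a > 0\<close>, and \<open>0 / 0 = 0\<close>, in the extended reals).
\<close>

definition integrality_gap :: "nat \<Rightarrow> point set \<Rightarrow> ereal" where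
  "integrality_gap n S =
     (SUP (f, c)\<in>{(f, c). admissible_objective n f c}.
        optimal_cost n f c (mixed_integer_solutions n) / max 0 (optimal_cost n f c S))"

text \<open>
  Polynomials in the classic variables are finitely supported maps from monomials (exponent
  vectors) to coefficients; their multiplication is the convolution product of
  \<open>HOL-Library.Poly_Mapping\<close>.
\<close>

type_synonym polynomial = "((var, nat) poly_mapping, real) poly_mapping"

definition const_poly :: "real \<Rightarrow> polynomial" where
  "const_poly r = Poly_Mapping.single 0 r"

definition var_poly :: "var \<Rightarrow> polynomial" where
  "var_poly v = Poly_Mapping.single (Poly_Mapping.single v 1) 1"

definition lifted_constraint :: "nat \<Rightarrow> inequality \<Rightarrow> nat set \<Rightarrow> nat set \<Rightarrow> polynomial" where
  "lifted_constraint n \<pi> A W =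
     ((\<Sum>v\<in>variables n. const_poly (fst \<pi> v) * var_poly v) - const_poly (snd \<pi>)) *
     (\<Prod>i\<in>A - W. var_poly (Yvar i)) * (\<Prod>i\<in>W. 1 - var_poly (Yvar i))"

text \<open>
  Linearization forgets exponents (\<open>y_i^2\<close> becomes \<open>y_i\<close>) and replaces the resulting product of
  the variables in a set \<open>M\<close> by the value \<open>w M\<close> of a new variable: \<open>w (Yvar ` S)\<close> is \<open>y_S\<close> and
  \<open>w (insert (Xvar i j) (Yvar ` S))\<close> is \<open>v_{S,ij}\<close>. A monomial of a lifted constraint
  contains at most one assignment variable, with exponent 1, so no other sets arise.
\<close>

definition linearize :: "(var set \<Rightarrow> real) \<Rightarrow> polynomial \<Rightarrow> real" where
  "linearize w p = (\<Sum>m\<in>Poly_Mapping.keys p. Poly_Mapping.lookup p m * w (Poly_Mapping.keys m))"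

text \<open>The procedure acts on a description \<open>D\<close> of the relaxation. The empty product is the constant
  1, and the new variables belonging to singletons are the classic variables.\<close>

definition sherali_adams :: "nat \<Rightarrow> nat \<Rightarrow> inequality set \<Rightarrow> point set" where
  "sherali_adams n t D =
     {z \<in> space_of n. \<exists>w. w {} = 1 \<and> (\<forall>v\<in>variables n. w {v} = Poly_Mapping.lookup z v) \<and>
        (\<forall>\<pi>\<in>D. \<forall>A W. A \<subseteq> facilities n \<and> card A \<le> t \<and> W \<subseteq> A \<longrightarrow>
           linearize w (lifted_constraint n \<pi> A W) \<le> 0)}"

end

theory Submission
  imports Defs
begin

text \<open>
  Split the facilities at random into \<open>T\<close>, \<open>R\<close> and \<open>S\<close> of size \<open>n\<close> each. Opening is free on \<open>T \<union> R\<close>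
  and costs 1 on \<open>S\<close>; assignment is free on \<open>T \<union> S\<close> and costs \<open>2^(n^2)\<close> on \<open>R\<close>. As \<open>T\<close> falls short
  of the demand by \<open>2^(-n^2)\<close>, every mixed integer solution costs at least 1. With probability
  \<open>1 - 1/n\<close> open \<open>T \<union> R\<close> and overload \<open>T\<close> slightly, otherwise open in addition a random \<open>s \<in> S\<close> that
  takes over an equal share of the demand. The mean of this distribution costs \<open>1/n\<close>, and its moments
  are the lifted variables; conditioning on at most \<open>n/2\<close> facilities only shrinks \<open>S\<close>.

  A valid inequality separates few of these means. If it separated those of \<open>(T, R)\<close> and \<open>(T', R')\<close>
  with \<open>R \<inter> T'\<close> and \<open>R' \<inter> T\<close> both nonempty, a facility in each of the two intersections could absorb
  the overload of one point at the expense of the other, so that a combination of both means would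
  be a combination of mixed integer solutions. Hence an inequality separates at most
  \<open>2 (2n choose n)^2\<close> of the \<open>(3n choose n) (2n choose n)\<close> pairs \<open>(T, R)\<close>, a fraction of at most
  \<open>2 (2/3)^n\<close>.
\<close>

subsection \<open>Counting\<close>

text \<open>Double counting: every ordered pair of \<open>Q\<close> lies in \<open>E\<close> or in
  its converse, so \<open>card Q * card Q \<le> 2 * card E\<close>, while \<open>few\<close> gives
  \<open>card E \<le> card Q * k\<close>.\<close>

lemma card_le_if_one_sided_disjoint:
  fixes Q :: "('a set \<times> 'a set) set"
  assumes fin: "finite Q"
    and one_sided: "\<And>p q. p \<in> Q \<Longrightarrow> q \<in> Q \<Longrightarrow> snd p \<inter> fst q = {} \<or> snd q \<inter> fst p = {}"
    and few: "\<And>p. p \<in> Q \<Longrightarrow> card {q \<in> Q. snd p \<inter> fst q = {}} \<le> k"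
  shows "card Q \<le> 2 * k"
proof -
  define E where "E = (SIGMA p:Q. {q \<in> Q. snd p \<inter> fst q = {}})"
  have finE: "finite E"
    using fin by (auto simp: E_def)
  have "card E = (\<Sum>p\<in>Q. card {q \<in> Q. snd p \<inter> fst q = {}})"
    unfolding E_def using fin by (intro card_SigmaI) auto
  also have "\<dots> \<le> (\<Sum>p\<in>Q. k)"
    by (intro sum_mono few)
  finally have cE: "card E \<le> card Q * k" by simp
  have "Q \<times> Q \<subseteq> E \<union> E\<inverse>"
  proof
    fix x assume "x \<in> Q \<times> Q"
    thus "x \<in> E \<union> E\<inverse>"
      using one_sided[of "fst x" "snd x"] by (cases x) (auto simp: E_def)
  qed
  hence "card (Q \<times> Q) \<le> card (E \<union> E\<inverse>)"
    using finE by (intro card_mono) auto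
  also have "\<dots> \<le> card E + card (E\<inverse>)"
    by (rule card_Un_le)
  also have "\<dots> \<le> card Q * (2 * k)"
    using cE by (simp add: card_inverse)
  finally show ?thesis
    by (cases "card Q = 0") (auto simp: card_cartesian_product)
qed

text \<open>Both binomials are products over \<open>i < n\<close> with denominators
  \<open>n - i\<close>; the numerators compare factor by factor, as
  \<open>3 / 2 * (2 * n - i) = 3 * n - 3 / 2 * i \<le> 3 * n - i\<close>.\<close>

lemma binomial_ratio:
  "(3 / 2) ^ n * real ((2 * n) choose n) \<le> real ((3 * n) choose n)"
proof -
  have "(3 / 2) ^ n * real ((2 * n) choose n)
      = (\<Prod>i = 0..<n. 3 / 2 * ((real (2 * n) - real i) / real (n - i)))"
    by (simp only: binomial_gbinomial gbinomial_altdef_of_nat prod.distrib prod_constant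
        card_atLeastLessThan diff_zero)
  also have "\<dots> \<le> (\<Prod>i = 0..<n. (real (3 * n) - real i) / real (n - i))"
  proof (intro prod_mono conjI)
    fix i assume "i \<in> {0..<n}"
    thus "0 \<le> 3 / 2 * ((real (2 * n) - real i) / real (n - i))"
      by auto
    have "3 / 2 * ((real (2 * n) - real i) / real (n - i)) = (3 * real n - 3 / 2 * real i) / real (n - i)"
      by (simp add: field_simps)
    also have "\<dots> \<le> (real (3 * n) - real i) / real (n - i)"
      by (intro divide_right_mono) auto
    finally show "3 / 2 * ((real (2 * n) - real i) / real (n - i)) \<le> (real (3 * n) - real i) / real (n - i)" .
  qed
  also have "\<dots> = real ((3 * n) choose n)"
    by (simp add: binomial_gbinomial gbinomial_altdef_of_nat)
  finally show ?thesis .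
qed

definition splits :: "'a set \<Rightarrow> nat \<Rightarrow> ('a set \<times> 'a set) set" where
  "splits F n = (SIGMA T:{T. T \<subseteq> F \<and> card T = n}. {R. R \<subseteq> F - T \<and> card R = n})"

lemma finite_splits: "finite F \<Longrightarrow> finite (splits F n)"
  unfolding splits_def by (intro finite_SigmaI) auto

text \<open>Choose the first part outside \<open>R\<close>, then the second outside the first. The
  instance \<open>R = {}\<close> counts all splits.\<close>

lemma card_splits_disjoint:
  assumes "finite F" "R \<subseteq> F"
  shows "card {q \<in> splits F n. R \<inter> fst q = {}}
       = ((card F - card R) choose n) * ((card F - n) choose n)"
proof -
  have "{q \<in> splits F n. R \<inter> fst q = {}}
      = (SIGMA T:{T. T \<subseteq> F - R \<and> card T = n}. {R. R \<subseteq> F - T \<and> card R = n})"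
    by (auto simp: splits_def)
  also have "card \<dots> = (\<Sum>T\<in>{T. T \<subseteq> F - R \<and> card T = n}. card {R. R \<subseteq> F - T \<and> card R = n})"
    using assms by (intro card_SigmaI) auto
  also have "\<dots> = (\<Sum>T\<in>{T. T \<subseteq> F - R \<and> card T = n}. (card F - n) choose n)"
  proof (intro sum.cong refl)
    fix T assume "T \<in> {T. T \<subseteq> F - R \<and> card T = n}"
    hence "card (F - T) = card F - n"
      using assms by (subst card_Diff_subset) (auto intro: finite_subset)
    thus "card {R. R \<subseteq> F - T \<and> card R = n} = (card F - n) choose n"
      using assms by (simp add: n_subsets)
  qed
  also have "\<dots> = ((card F - card R) choose n) * ((card F - n) choose n)"
    using assms by (simp add: n_subsets card_Diff_subset finite_subset)
  finally show ?thesis .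
qed

lemma exists_unseparated_split:
  fixes bad :: "'b \<Rightarrow> 'a set \<times> 'a set \<Rightarrow> bool"
  assumes F: "finite F" "card F = 3 * n" and D: "finite D"
    and few: "2 * real (card D) < (3 / 2) ^ n"
    and one_sided: "\<And>\<pi> p q. \<pi> \<in> D \<Longrightarrow> p \<in> splits F n \<Longrightarrow> q \<in> splits F n \<Longrightarrow> bad \<pi> p \<Longrightarrow> bad \<pi> q \<Longrightarrow>
      snd p \<inter> fst q = {} \<or> snd q \<inter> fst p = {}"
  shows "\<exists>p\<in>splits F n. \<forall>\<pi>\<in>D. \<not> bad \<pi> p"
proof (rule ccontr)
  assume "\<not> ?thesis"
  hence cover: "splits F n \<subseteq> (\<Union>\<pi>\<in>D. {p \<in> splits F n. bad \<pi> p})"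
    by auto
  let ?b = "(2 * n) choose n"
  note fin = finite_splits[OF F(1), of n]
  have bad_le: "card {p \<in> splits F n. bad \<pi> p} \<le> 2 * (?b * ?b)" if "\<pi> \<in> D" for \<pi>
  proof (rule card_le_if_one_sided_disjoint)
    fix p assume p: "p \<in> {p \<in> splits F n. bad \<pi> p}"
    hence R: "snd p \<subseteq> F" "card (snd p) = n"
      by (auto simp: splits_def)
    have "card {q \<in> {p \<in> splits F n. bad \<pi> p}. snd p \<inter> fst q = {}}
        \<le> card {q \<in> splits F n. snd p \<inter> fst q = {}}"
      using fin by (intro card_mono) auto
    also have "\<dots> = ?b * ?b"
      using card_splits_disjoint[OF F(1) R(1), of n] R(2) F(2) by simp
    finally show "card {q \<in> {p \<in> splits F n. bad \<pi> p}. snd p \<inter> fst q = {}} \<le> ?b * ?b" .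
  qed (use fin one_sided[OF that] in auto)
  have "((3 * n) choose n) * ?b = card (splits F n)"
    using card_splits_disjoint[OF F(1), of "{}" n] F(2) by simp
  also have "\<dots> \<le> card (\<Union>\<pi>\<in>D. {p \<in> splits F n. bad \<pi> p})"
    using D fin by (intro card_mono cover) auto
  also have "\<dots> \<le> (\<Sum>\<pi>\<in>D. card {p \<in> splits F n. bad \<pi> p})"
    by (rule card_UN_le[OF D])
  also have "\<dots> \<le> (\<Sum>\<pi>\<in>D. 2 * (?b * ?b))"
    by (intro sum_mono bad_le)
  finally have "((3 * n) choose n) * ?b \<le> (2 * card D * ?b) * ?b"
    by (simp add: algebra_simps)
  hence "(3 * n) choose n \<le> 2 * card D * ?b"
    by simp
  hence "real ((3 * n) choose n) \<le> 2 * real (card D) * real ?b"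
    by (metis of_nat_le_iff of_nat_mult of_nat_numeral)
  moreover have "2 * real (card D) * real ?b < (3 / 2) ^ n * real ?b"
    using few by (intro mult_strict_right_mono) auto
  ultimately show False
    using binomial_ratio[of n] by linarith
qed

subsection \<open>Points and inequalities\<close>

lemma finite_facilities [simp]: "finite (facilities n)"
  and finite_clients [simp]: "finite (clients n)"
  and card_facilities [simp]: "card (facilities n) = 3 * n"
  and card_clients [simp]: "card (clients n) = n ^ 4 + 1"
  by (simp_all add: facilities_def clients_def)

lemma finite_variables [simp]: "finite (variables n)"
  by (simp add: variables_def)

lemma Yvar_in_variables [simp]: "Yvar i \<in> variables n \<longleftrightarrow> i \<in> facilities n"
  and Xvar_in_variables [simp]: "Xvar i j \<in> variables n \<longleftrightarrow> i \<in> facilities n \<and> j \<in> clients n"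
  by (auto simp: variables_def)

definition restricted_point :: "nat \<Rightarrow> (var \<Rightarrow> real) \<Rightarrow> point" where
  "restricted_point n h = Abs_poly_mapping (\<lambda>v. if v \<in> variables n then h v else 0)"

lemma lookup_restricted_point:
  "Poly_Mapping.lookup (restricted_point n h) v = (if v \<in> variables n then h v else 0)"
proof -
  have "finite {v. (if v \<in> variables n then h v else 0) \<noteq> 0}"
    by (rule finite_subset[of _ "variables n"]) auto
  thus ?thesis
    by (simp add: restricted_point_def Abs_poly_mapping_inverse)
qed

lemma restricted_point_in_space [simp]: "restricted_point n h \<in> space_of n"
  by (auto simp: space_of_def in_keys_iff lookup_restricted_point split: if_splits)

text \<open>Defined on functions instead of \<open>point\<close>s, so that means can be formed
  pointwise; \<open>restricted_point\<close> turns them into points afterwards.\<close>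

definition excess :: "nat \<Rightarrow> inequality \<Rightarrow> (var \<Rightarrow> real) \<Rightarrow> real" where
  "excess n \<pi> h = (\<Sum>v\<in>variables n. fst \<pi> v * h v) - snd \<pi>"

lemma excess_lookup_restricted_point:
  "excess n \<pi> (Poly_Mapping.lookup (restricted_point n h)) = excess n \<pi> h"
  by (simp add: excess_def lookup_restricted_point)

lemma in_solution_set_iff:
  "z \<in> solution_set n D \<longleftrightarrow> z \<in> space_of n \<and> (\<forall>\<pi>\<in>D. excess n \<pi> (Poly_Mapping.lookup z) \<le> 0)"
  by (auto simp: solution_set_def excess_def)

text \<open>The excess is affine, not linear: the last term remains when the weights do not sum to
  1.\<close>

lemma excess_combination:
  "excess n \<pi> (\<lambda>v. c * g v + d * (\<Sum>s\<in>S. h s v))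
     = c * excess n \<pi> g + d * (\<Sum>s\<in>S. excess n \<pi> (h s)) - (1 - c - d * real (card S)) * snd \<pi>"
proof -
  have "(\<Sum>v\<in>variables n. fst \<pi> v * (c * g v + d * (\<Sum>s\<in>S. h s v)))
      = c * (\<Sum>v\<in>variables n. fst \<pi> v * g v) + d * (\<Sum>v\<in>variables n. \<Sum>s\<in>S. fst \<pi> v * h s v)"
    by (simp add: algebra_simps sum.distrib sum_distrib_left)
  also have "(\<Sum>v\<in>variables n. \<Sum>s\<in>S. fst \<pi> v * h s v) = (\<Sum>s\<in>S. \<Sum>v\<in>variables n. fst \<pi> v * h s v)"
    by (rule sum.swap)
  finally show ?thesis
    by (simp add: excess_def sum_subtractf algebra_simps)
qed

subsection \<open>The infeasible point and its repairs\<close>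

text \<open>All clients are treated alike: \<open>x i\<close> is the share of each client's demand
  served by \<open>i\<close>, so the load of \<open>i\<close> is \<open>n ^ 4 + 1\<close> times
  \<open>x i\<close>.\<close>

definition profile :: "nat set \<Rightarrow> (nat \<Rightarrow> real) \<Rightarrow> var \<Rightarrow> real" where
  "profile V x v = (case v of Yvar i \<Rightarrow> of_bool (i \<in> V) | Xvar i j \<Rightarrow> x i)"

lemma profile_simps [simp]:
  "profile V x (Yvar i) = of_bool (i \<in> V)" "profile V x (Xvar i j) = x i"
  by (simp_all add: profile_def)

text \<open>The fraction of the total demand that is lost when only \<open>n\<close> facilities are open.\<close>

definition deficit :: "nat \<Rightarrow> real" where
  "deficit n = 2 powr (- real (n ^ 2)) / real (n ^ 4 + 1)"

lemma deficit_pos: "deficit n > 0"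
proof -
  have "real (n ^ 4 + 1) > 0" by (simp only: of_nat_0_less_iff)
  thus ?thesis unfolding deficit_def by (intro divide_pos_pos) auto
qed

text \<open>Measured in shares, one facility can serve \<open>(1 - deficit n) / n\<close>, just
  below an n-th part of the demand.\<close>

lemma capacity_deficit:
  assumes "n \<ge> 1"
  shows "capacity n = real (n ^ 4 + 1) * ((1 - deficit n) / real n)"
proof -
  have "real (n ^ 4 + 1) \<noteq> 0" by (simp only: of_nat_eq_0_iff)
  hence "real (n ^ 4 + 1) * deficit n = 2 powr (- real (n ^ 2))"
    unfolding deficit_def by simp
  thus ?thesis
    using assms by (simp add: capacity_def right_diff_distrib)
qed

text \<open>A crude estimate suffices: \<open>2 powr (- n ^ 2)\<close> is at most 1, and
  \<open>n ^ 4 + 1\<close> alone dominates the product. Cleared of denominators, the first bound of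
  \<open>deficit_bounds\<close> is this inequality.\<close>

lemma deficit_small:
  assumes "n \<ge> 2"
  shows "deficit n * ((2 * real n + 1) * (real n + 1)) \<le> 1"
proof -
  have "2 * 2 * n \<le> n * n * n"
    using assms by (intro mult_right_mono mult_mono) auto
  hence "2 * n + 3 \<le> n * n * n"
    using assms by linarith
  hence "n * (2 * n + 3) \<le> n * (n * n * n)"
    by (rule mult_left_mono) simp
  hence "(2 * n + 1) * (n + 1) \<le> n ^ 4 + 1"
    by (simp add: algebra_simps power4_eq_xxxx)
  hence le: "real ((2 * n + 1) * (n + 1)) \<le> real (n ^ 4 + 1)"
    by (simp only: of_nat_le_iff)
  have "2 powr (- real (n ^ 2)) \<le> (1::real)"
    by (simp add: powr_le_one_le powr_minus_divide ge_one_powr_ge_zero)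
  hence "2 powr (- real (n ^ 2)) * real ((2 * n + 1) * (n + 1)) \<le> 1 * real (n ^ 4 + 1)"
    using le by (intro mult_mono) auto
  moreover have "real (n ^ 4 + 1) > 0" by (simp only: of_nat_0_less_iff)
  ultimately have "2 powr (- real (n ^ 2)) * real ((2 * n + 1) * (n + 1)) / real (n ^ 4 + 1) \<le> 1"
    by (subst divide_le_eq) auto
  thus ?thesis
    by (simp add: deficit_def algebra_simps)
qed

text \<open>Room for the exchange, in this order: a facility with share \<open>1 / (n + 1)\<close>
  can take \<open>2 * deficit n\<close> more and can give up \<open>2 * n * deficit n\<close>; an
  empty one can absorb the whole deficit; no capacity share exceeds 1.\<close>

lemma deficit_bounds:
  assumes "n \<ge> 2"
  shows "1 / (real n + 1) + 2 * deficit n \<le> (1 - deficit n) / real n"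
    and "2 * real n * deficit n \<le> 1 / (real n + 1)"
    and "deficit n \<le> (1 - deficit n) / real n"
    and "(1 - deficit n) / real n \<le> 1"
proof -
  let ?e = "deficit n" and ?r = "real n"
  have r: "?r \<ge> 2" using assms by simp
  have e: "?e > 0" by (rule deficit_pos)
  have small: "?e * ((2 * ?r + 1) * (?r + 1)) \<le> 1" by (rule deficit_small[OF assms])
  show 1: "1 / (?r + 1) + 2 * ?e \<le> (1 - ?e) / ?r"
  proof -
    have "(1 - ?e) / ?r - (1 / (?r + 1) + 2 * ?e) = (1 - ?e * ((2 * ?r + 1) * (?r + 1))) / (?r * (?r + 1))"
      using r by (simp add: field_simps)
    also have "\<dots> \<ge> 0" using small r by (intro divide_nonneg_nonneg) auto
    finally show ?thesis by simp
  qed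
  have "2 * ?r * ?e * (?r + 1) \<le> ?e * ((2 * ?r + 1) * (?r + 1))"
    using r e by (simp add: algebra_simps)
  hence "2 * ?r * ?e * (?r + 1) \<le> 1" using small by linarith
  thus "2 * ?r * ?e \<le> 1 / (?r + 1)" using r by (simp add: field_simps)
  show "?e \<le> (1 - ?e) / ?r" using 1 e r by (smt (verit) divide_nonneg_nonneg)
  show "(1 - ?e) / ?r \<le> 1" using e r by (simp add: divide_le_eq)
qed

definition valid_inequality :: "nat \<Rightarrow> inequality \<Rightarrow> bool" where
  "valid_inequality n \<pi> \<longleftrightarrow>
     (\<forall>z\<in>mixed_integer_solutions n. excess n \<pi> (Poly_Mapping.lookup z) \<le> 0)"

text \<open>For client-independent assignments, feasibility reduces to the listed conditions on the
  shares.\<close>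

lemma excess_profile_le:
  assumes n: "n \<ge> 2" and valid: "valid_inequality n \<pi>"
    and x: "\<And>i. 0 \<le> x i" "\<And>i. x i \<le> (1 - deficit n) / real n" "\<And>i. i \<notin> V \<Longrightarrow> x i = 0"
    and total: "(\<Sum>i\<in>facilities n. x i) = 1"
  shows "excess n \<pi> (profile V x) \<le> 0"
proof -
  have x1: "x i \<le> 1" for i
    using x(2)[of i] deficit_bounds(4)[OF n] by linarith
  have cap: "capacity n = real (n ^ 4 + 1) * ((1 - deficit n) / real n)"
    using n by (intro capacity_deficit) auto
  have cap_le: "real (n ^ 4 + 1) * x i \<le> capacity n" for i
    unfolding cap by (intro mult_left_mono x) auto
  define z where "z = restricted_point n (profile V x)"
  have y: "yval z i = of_bool (i \<in> V)" if "i \<in> facilities n" for i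
    using that by (simp add: z_def lookup_restricted_point)
  have xv: "xval z i j = x i" if "i \<in> facilities n" "j \<in> clients n" for i j
    using that by (simp add: z_def lookup_restricted_point)
  have "z \<in> mixed_integer_solutions n"
    unfolding mixed_integer_solutions_def mixed_integral_def
  proof (intro CollectI conjI ballI)
    show "z \<in> space_of n" by (simp add: z_def)
  next
    fix i assume i: "i \<in> facilities n"
    show "yval z i \<in> {0, 1}" by (simp add: y i)
    have "(\<Sum>j\<in>clients n. xval z i j) = real (n ^ 4 + 1) * x i"
      by (simp add: xv i)
    thus "(\<Sum>j\<in>clients n. xval z i j) \<le> capacity n * yval z i"
      using cap_le[of i] x(3)[of i] by (cases "i \<in> V") (simp_all add: y i)
    fix j assume j: "j \<in> clients n"
    show "xval z i j \<in> {0..1}" "0 \<le> xval z i j" by (simp_all add: xv i j x(1) x1)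
    show "xval z i j \<le> yval z i"
      using x1[of i] x(3)[of i] by (cases "i \<in> V") (simp_all add: xv y i j)
  next
    fix j assume j: "j \<in> clients n"
    have "(\<Sum>i\<in>facilities n. xval z i j) = (\<Sum>i\<in>facilities n. x i)"
      by (intro sum.cong refl xv j)
    thus "(\<Sum>i\<in>facilities n. xval z i j) = 1" by (simp only: total)
  qed
  hence "excess n \<pi> (Poly_Mapping.lookup z) \<le> 0"
    using valid by (simp add: valid_inequality_def)
  thus ?thesis
    by (simp only: z_def excess_lookup_restricted_point)
qed

text \<open>The share \<open>1 / n\<close> exceeds the capacity share by
  \<open>deficit n / n\<close>, so \<open>T\<close> is slightly overloaded, while \<open>R\<close>
  is open but empty.\<close>

definition overfull :: "nat \<Rightarrow> nat set \<Rightarrow> nat set \<Rightarrow> var \<Rightarrow> real" where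
  "overfull n T R = profile (T \<union> R) (\<lambda>i. of_bool (i \<in> T) / real n)"

definition relieved :: "nat \<Rightarrow> nat set \<Rightarrow> nat set \<Rightarrow> nat \<Rightarrow> var \<Rightarrow> real" where
  "relieved n T R s = profile (insert s (T \<union> R)) (\<lambda>i. of_bool (i \<in> insert s T) / (real n + 1))"

lemma sum_of_bool_mult:
  assumes "finite A" "B \<subseteq> A"
  shows "(\<Sum>i\<in>A. of_bool (i \<in> B) * c) = real (card B) * (c::real)"
proof -
  have "(\<Sum>i\<in>A. of_bool (i \<in> B) * c) = (\<Sum>i\<in>B. of_bool (i \<in> B) * c)"
    using assms by (intro sum.mono_neutral_right) auto
  thus ?thesis by simp
qed

lemma excess_relieved_le:
  assumes n: "n \<ge> 2" and valid: "valid_inequality n \<pi>"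
    and T: "T \<subseteq> facilities n" "card T = n" and s: "s \<in> facilities n - T"
  shows "excess n \<pi> (relieved n T R s) \<le> 0"
  unfolding relieved_def
proof (rule excess_profile_le[OF n valid])
  have card: "card (insert s T) = n + 1"
    using T s finite_subset[OF T(1)] by simp
  have "(\<Sum>i\<in>facilities n. of_bool (i \<in> insert s T) * (1 / (real n + 1)))
      = real (card (insert s T)) * (1 / (real n + 1))"
    using T s by (intro sum_of_bool_mult) auto
  also have "\<dots> = 1"
    unfolding card by (simp add: add_nonneg_eq_0_iff)
  finally show "(\<Sum>i\<in>facilities n. of_bool (i \<in> insert s T) / (real n + 1)) = 1"
    by (simp only: times_divide_eq_right mult_1_right)
next
  fix i
  show "0 \<le> of_bool (i \<in> insert s T) / (real n + 1)"
    by (intro divide_nonneg_nonneg) auto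
  have "of_bool (i \<in> insert s T) / (real n + 1) \<le> 1 / (real n + 1)"
    by (intro divide_right_mono) auto
  thus "of_bool (i \<in> insert s T) / (real n + 1) \<le> (1 - deficit n) / real n"
    using deficit_bounds(1)[OF n] deficit_pos[of n] by linarith
  assume "i \<notin> insert s (T \<union> R)"
  hence "i \<notin> insert s T" by blast
  thus "of_bool (i \<in> insert s T) / (real n + 1) = 0"
    by (simp only: of_bool_eq div_0)
qed

text \<open>The exchange: \<open>r\<close> relieves \<open>T\<close> in the first overloaded point, \<open>t\<close> relieves \<open>T'\<close> in the
  second one. The surplus at \<open>t\<close> is taken from the first relieved point and the surplus at \<open>r\<close> from
  the second one, where those facilities carry demand.\<close>

lemma exchange:
  assumes n: "n \<ge> 2" and valid: "valid_inequality n \<pi>"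
    and T: "T \<subseteq> facilities n" "card T = n" "s \<in> facilities n - T"
    and T': "T' \<subseteq> facilities n" "card T' = n" "s' \<in> facilities n - T'"
    and r: "r \<in> R" "r \<in> T'" "r \<notin> T" and t: "t \<in> R'" "t \<in> T" "t \<notin> T'"
  shows "2 * real n * excess n \<pi> (overfull n T R) + excess n \<pi> (relieved n T R s)
       + (2 * real n * excess n \<pi> (overfull n T' R') + excess n \<pi> (relieved n T' R' s')) \<le> 0"
proof -
  define e where "e = deficit n"
  define k where "k = (1 - deficit n) / real n"
  define p where "p = 1 / (real n + 1)"
  define d where "d = 2 * real n * e"
  have e: "e > 0" unfolding e_def by (rule deficit_pos)
  have bounds: "p + 2 * e \<le> k" "d \<le> p" "e \<le> k"
    using deficit_bounds[OF n] by (simp_all add: e_def k_def p_def d_def)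
  have d0: "d \<ge> 0" using e by (simp add: d_def)
  have p0: "p \<ge> 0" by (simp add: p_def)
  have k0: "k \<ge> 0" using bounds p0 e by linarith
  have nk: "real n * k = 1 - e" using n by (simp add: k_def e_def)
  have np: "(real n + 1) * p = 1" by (simp add: p_def add_nonneg_eq_0_iff)
  \<comment> \<open>\<open>V\<close> repairs an overfull point: \<open>T\<close> is filled to
    capacity, and the missing share \<open>e\<close> goes to the open but empty
    \<open>r\<close>.\<close>
  define V where "V T r i = of_bool (i \<in> T) * k + of_bool (i \<in> {r}) * e" for T and r i :: nat
  \<comment> \<open>Scaled by \<open>2 * n\<close>, the repair takes \<open>2 * e\<close> off each
    facility of \<open>T\<close>; \<open>Q\<close> gives it back. In return \<open>Q\<close> drops
    \<open>d\<close> at \<open>t\<close>, where the other repair adds it. As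
    \<open>d = 2 * n * e\<close>, the total stays 1.\<close>
  define Q where "Q T s t i = of_bool (i \<in> insert s T) * p + of_bool (i \<in> T) * (2 * e)
    - of_bool (i \<in> {t}) * d" for T and s t i :: nat
  have V_le: "excess n \<pi> (profile (T \<union> R) (V T r)) \<le> 0"
    if "T \<subseteq> facilities n" "card T = n" "r \<in> facilities n" "r \<notin> T" "r \<in> R" for T R r
  proof (rule excess_profile_le[OF n valid])
    have "(\<Sum>i\<in>facilities n. V T r i) = real (card T) * k + real (card {r}) * e"
      unfolding V_def sum.distrib using that by (intro arg_cong2[of _ _ _ _ "(+)"] sum_of_bool_mult) auto
    thus "(\<Sum>i\<in>facilities n. V T r i) = 1"
      using that nk by simp
    show "0 \<le> V T r i" for i
      using e k0 by (simp add: V_def)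
    show "V T r i \<le> (1 - deficit n) / real n" for i
      unfolding k_def[symmetric] using that bounds(3) k0
      by (cases "i \<in> T"; cases "i = r") (simp_all add: V_def)
    show "V T r i = 0" if "i \<notin> T \<union> R" for i
    proof -
      have "i \<notin> T" "i \<notin> {r}" using that \<open>r \<in> R\<close> by auto
      thus ?thesis by (simp add: V_def)
    qed
  qed
  have Q_le: "excess n \<pi> (profile (insert s (T \<union> R)) (Q T s t)) \<le> 0"
    if "T \<subseteq> facilities n" "card T = n" "s \<in> facilities n - T" "t \<in> T" for T R s t
  proof (rule excess_profile_le[OF n valid])
    have card: "card (insert s T) = n + 1"
      using that finite_subset[OF that(1)] by simp
    have "(\<Sum>i\<in>facilities n. Q T s t i)
        = real (card (insert s T)) * p + real (card T) * (2 * e) - real (card {t}) * d"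
      unfolding Q_def sum.distrib sum_subtractf using that
      by (intro arg_cong2[of _ _ _ _ "(+)"] arg_cong2[of _ _ _ _ "(-)"] sum_of_bool_mult) auto
    also have "\<dots> = (real n + 1) * p"
      unfolding card that(2) by (simp add: d_def algebra_simps)
    finally show "(\<Sum>i\<in>facilities n. Q T s t i) = 1"
      unfolding np .
    have cases: "Q T s t i = (if i \<in> T then p + 2 * e - (if i = t then d else 0) else if i = s then p else 0)" for i
      using that by (auto simp: Q_def)
    show "0 \<le> Q T s t i" for i
      unfolding cases using bounds e p0 d0 by simp
    show "Q T s t i \<le> (1 - deficit n) / real n" for i
      unfolding cases k_def[symmetric] using bounds e p0 d0 k0 by simp
    show "i \<notin> insert s (T \<union> R) \<Longrightarrow> Q T s t i = 0" for i
      unfolding cases by simp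
  qed
  let ?n = "2 * real n"
  \<comment> \<open>Open sets are unchanged by the repairs. For the assignments, the surpluses
    \<open>d\<close> at \<open>r\<close> and \<open>t\<close> cancel crosswise.\<close>
  have pointwise: "?n * overfull n T R v + relieved n T R s v
       + (?n * overfull n T' R' v + relieved n T' R' s' v)
     = ?n * profile (T \<union> R) (V T r) v + profile (insert s (T \<union> R)) (Q T s t) v
       + (?n * profile (T' \<union> R') (V T' t) v + profile (insert s' (T' \<union> R')) (Q T' s' r) v)" for v
  proof (cases v)
    case (Xvar i j)
    have over: "?n * (of_bool (i \<in> T) / real n) = of_bool (i \<in> T) * 2" for T
      using n by simp
    have "?n * k = 2 - 2 * e" using nk by simp
    hence V: "?n * V T r i = of_bool (i \<in> T) * (2 - 2 * e) + of_bool (i \<in> {r}) * d" for T r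
      unfolding V_def d_def by (metis distrib_left mult.assoc mult.left_commute)
    have p: "of_bool B / (real n + 1) = of_bool B * p" for B
      by (simp add: p_def)
    show ?thesis
      unfolding Xvar overfull_def relieved_def profile_simps over V p Q_def
      by (simp only: algebra_simps)
  qed (simp add: overfull_def relieved_def)
  \<comment> \<open>Both combinations have total weight \<open>4 * n + 2\<close>, so
    \<open>snd \<pi>\<close> enters them equally and \<open>lin\<close> can be used in both
    directions.\<close>
  have lin: "?n * excess n \<pi> a + excess n \<pi> b + (?n * excess n \<pi> c + excess n \<pi> d)
    = (\<Sum>v\<in>variables n. fst \<pi> v * (?n * a v + b v + (?n * c v + d v))) - (2 * ?n + 2) * snd \<pi>"
    for a b c d
    by (simp add: excess_def algebra_simps sum.distrib sum_distrib_left)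
  have "?n * excess n \<pi> (profile (T \<union> R) (V T r)) \<le> 0" "?n * excess n \<pi> (profile (T' \<union> R') (V T' t)) \<le> 0"
    using V_le[of T r R] V_le[of T' t R'] T T' r t by (auto intro!: mult_nonneg_nonpos)
  moreover have "excess n \<pi> (profile (insert s (T \<union> R)) (Q T s t)) \<le> 0"
    "excess n \<pi> (profile (insert s' (T' \<union> R')) (Q T' s' r)) \<le> 0"
    by (rule Q_le[OF T t(2)], rule Q_le[OF T' r(2)])
  ultimately show ?thesis
    unfolding lin pointwise unfolding lin[symmetric] by linarith
qed

section \<open>Conditional means and their separation\<close>

text \<open>For \<open>n \<ge> 2\<close> a positive multiple of the excess of the mean, conditioned
  on the additional facility, if any, lying in \<open>S\<close>. Only the sign matters, so the
  weights are not normalized.\<close>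

definition conditional_excess :: "nat \<Rightarrow> inequality \<Rightarrow> nat set \<Rightarrow> nat set \<Rightarrow> nat set \<Rightarrow> real" where
  "conditional_excess n \<pi> T R S = (1 - 1 / real n) * excess n \<pi> (overfull n T R)
     + 1 / (real n)\<^sup>2 * (\<Sum>s\<in>S. excess n \<pi> (relieved n T R s))"

text \<open>Relieved points contribute nothing positive, so the overfull excess \<open>a\<close> is
  positive. If every \<open>s\<close> failed, the at least \<open>n / 2\<close> relieved terms would
  contribute at most \<open>- a\<close> in total, which outweighs \<open>(1 - 1 / n) * a\<close>.
  This explains the factor \<open>2 * n\<close> in \<open>exchange\<close>.\<close>

lemma conditional_excess_pos:
  assumes n: "n \<ge> 2" and S: "finite S" "n \<le> 2 * card S"
    and relieved: "\<And>s. s \<in> S \<Longrightarrow> excess n \<pi> (relieved n T R s) \<le> 0"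
    and pos: "conditional_excess n \<pi> T R S > 0"
  shows "\<exists>s\<in>S. 2 * real n * excess n \<pi> (overfull n T R) + excess n \<pi> (relieved n T R s) > 0"
proof (rule ccontr)
  assume "\<not> ?thesis"
  hence le: "excess n \<pi> (relieved n T R s) \<le> - (2 * real n * excess n \<pi> (overfull n T R))" if "s \<in> S" for s
    using that by force
  define a where "a = excess n \<pi> (overfull n T R)"
  define b where "b = (\<Sum>s\<in>S. excess n \<pi> (relieved n T R s))"
  have pos': "(1 - 1 / real n) * a + 1 / (real n)\<^sup>2 * b > 0"
    using pos by (simp only: conditional_excess_def a_def b_def)
  have "b \<le> 0"
    unfolding b_def by (intro sum_nonpos relieved)
  hence "1 / (real n)\<^sup>2 * b \<le> 0"
    by (intro mult_nonneg_nonpos) auto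
  moreover have n1: "0 \<le> 1 - 1 / real n" using n by simp
  ultimately have "a > 0"
    using pos' by (smt (verit) mult_nonneg_nonpos)
  have "b \<le> (\<Sum>s\<in>S. - (2 * real n * a))"
    unfolding b_def a_def by (intro sum_mono le)
  also have "\<dots> = - (real n * a * real (2 * card S))"
    by simp
  also have "\<dots> \<le> - (real n * a * real n)"
    using S(2) \<open>a > 0\<close> unfolding neg_le_iff_le by (intro mult_left_mono) (simp_all del: of_nat_mult)
  finally have "1 / (real n)\<^sup>2 * b \<le> 1 / (real n)\<^sup>2 * - (real n * a * real n)"
    by (intro mult_left_mono) auto
  also have "\<dots> = - a"
    using n by (simp add: power2_eq_square)
  finally have "(1 - 1 / real n) * a - a > 0"
    using pos' by linarith
  moreover have "(1 - 1 / real n) * a - a = - (a / real n)"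
    by (simp add: left_diff_distrib)
  ultimately show False
    using divide_pos_pos[OF \<open>a > 0\<close>, of "real n"] n by linarith
qed

text \<open>\<open>exchange\<close> rules out that an inequality is bad for two splits that meet
  crosswise, which is what the counting argument requires.\<close>

lemma exists_unseparated_partition:
  assumes n: "n \<ge> 2" and D: "finite D" "2 * real (card D) < (3 / 2) ^ n"
    and valid: "\<And>\<pi>. \<pi> \<in> D \<Longrightarrow> valid_inequality n \<pi>"
  shows "\<exists>T R. (T, R) \<in> splits (facilities n) n \<and> (\<forall>\<pi>\<in>D. \<forall>S. S \<subseteq> facilities n - T - R \<longrightarrow>
    n \<le> 2 * card S \<longrightarrow> conditional_excess n \<pi> T R S \<le> 0)"
proof -
  let ?F = "facilities n"
  \<comment> \<open>\<open>S\<close> is quantified inside \<open>bad\<close>, so the number of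
    possible conditionings does not enter the union bound.\<close>
  define bad where "bad \<pi> p \<longleftrightarrow> (\<exists>S \<subseteq> ?F - fst p - snd p. n \<le> 2 * card S \<and>
    conditional_excess n \<pi> (fst p) (snd p) S > 0)" for \<pi> and p :: "nat set \<times> nat set"
  have witness: "\<exists>s. s \<in> ?F - fst p - snd p \<and>
      2 * real n * excess n \<pi> (overfull n (fst p) (snd p)) + excess n \<pi> (relieved n (fst p) (snd p) s) > 0"
    if \<pi>: "\<pi> \<in> D" and p: "p \<in> splits ?F n" and "bad \<pi> p" for \<pi> p
  proof -
    obtain S where S: "S \<subseteq> ?F - fst p - snd p" "n \<le> 2 * card S"
        "conditional_excess n \<pi> (fst p) (snd p) S > 0"
      using \<open>bad \<pi> p\<close> by (auto simp: bad_def)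
    have T: "fst p \<subseteq> ?F" "card (fst p) = n"
      using p by (auto simp: splits_def)
    have "excess n \<pi> (relieved n (fst p) (snd p) s) \<le> 0" if "s \<in> S" for s
      using that S(1) by (intro excess_relieved_le n valid \<pi> T) auto
    moreover have "finite S"
      using S(1) by (rule finite_subset) auto
    ultimately obtain s where "s \<in> S"
      "2 * real n * excess n \<pi> (overfull n (fst p) (snd p)) + excess n \<pi> (relieved n (fst p) (snd p) s) > 0"
      using conditional_excess_pos[OF n _ S(2) _ S(3)] by blast
    thus ?thesis using S(1) by blast
  qed
  have "\<exists>p\<in>splits ?F n. \<forall>\<pi>\<in>D. \<not> bad \<pi> p"
  proof (rule exists_unseparated_split)
    fix \<pi> p q
    assume \<pi>: "\<pi> \<in> D" and p: "p \<in> splits ?F n" "bad \<pi> p" and q: "q \<in> splits ?F n" "bad \<pi> q"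
    show "snd p \<inter> fst q = {} \<or> snd q \<inter> fst p = {}"
    proof (rule ccontr)
      assume "\<not> ?thesis"
      then obtain r t where r: "r \<in> snd p" "r \<in> fst q" and t: "t \<in> snd q" "t \<in> fst p"
        by blast
      obtain s s' where s: "s \<in> ?F - fst p - snd p"
          "2 * real n * excess n \<pi> (overfull n (fst p) (snd p)) + excess n \<pi> (relieved n (fst p) (snd p) s) > 0"
        and s': "s' \<in> ?F - fst q - snd q"
          "2 * real n * excess n \<pi> (overfull n (fst q) (snd q)) + excess n \<pi> (relieved n (fst q) (snd q) s') > 0"
        using witness[OF \<pi> p] witness[OF \<pi> q] by blast
      have "2 * real n * excess n \<pi> (overfull n (fst p) (snd p)) + excess n \<pi> (relieved n (fst p) (snd p) s)
        + (2 * real n * excess n \<pi> (overfull n (fst q) (snd q)) + excess n \<pi> (relieved n (fst q) (snd q) s')) \<le> 0"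
        by (rule exchange[OF n valid[OF \<pi>], where r = r and t = t])
          (use p q s s' r t in \<open>auto simp: splits_def\<close>)
      with s s' show False by linarith
    qed
  qed (use D in auto)
  then obtain p where p: "p \<in> splits ?F n" "\<And>\<pi>. \<pi> \<in> D \<Longrightarrow> \<not> bad \<pi> p"
    by blast
  have "conditional_excess n \<pi> (fst p) (snd p) S \<le> 0"
    if "\<pi> \<in> D" "S \<subseteq> ?F - fst p - snd p" "n \<le> 2 * card S" for \<pi> S
    using p(2)[OF that(1)] that(2,3) unfolding bad_def by (meson not_le)
  thus ?thesis
    using p(1) by (intro exI[of _ "fst p"] exI[of _ "snd p"]) simp
qed

text \<open>The size bounds a smallest description, whereas the lifting acts on a given one.
  Nonpositive values on a whole description say that the mean, normalized by its total weight
  \<open>\<omega>\<close>, lies in the polyhedron, and this is independent of the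
  description.\<close>

lemma conditional_excess_le_transfer:
  assumes n: "n \<ge> 2" and same: "solution_set n D' = solution_set n D" and \<pi>: "\<pi> \<in> D"
    and le: "\<And>\<pi>'. \<pi>' \<in> D' \<Longrightarrow> conditional_excess n \<pi>' T R S \<le> 0"
  shows "conditional_excess n \<pi> T R S \<le> 0"
proof -
  define \<omega> where "\<omega> = 1 - 1 / real n + 1 / (real n)\<^sup>2 * real (card S)"
  have "1 - 1 / real n > 0" using n by simp
  hence \<omega>: "\<omega> > 0" by (simp add: \<omega>_def add_pos_nonneg)
  define h where "h = (\<lambda>v. (1 - 1 / real n) / \<omega> * overfull n T R v
    + 1 / (real n)\<^sup>2 / \<omega> * (\<Sum>s\<in>S. relieved n T R s v))"
  have h: "excess n \<pi> h = conditional_excess n \<pi> T R S / \<omega>" for \<pi>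
  proof -
    have "1 - (1 - 1 / real n) / \<omega> - 1 / (real n)\<^sup>2 / \<omega> * real (card S) = 1 - \<omega> / \<omega>"
      unfolding \<omega>_def by (simp only: add_divide_distrib times_divide_eq_left diff_diff_eq)
    hence "1 - (1 - 1 / real n) / \<omega> - 1 / (real n)\<^sup>2 / \<omega> * real (card S) = 0"
      using \<omega> by simp
    thus ?thesis
      unfolding h_def excess_combination conditional_excess_def
      by (simp only: add_divide_distrib times_divide_eq_left)
  qed
  have "restricted_point n h \<in> solution_set n D'"
    using le \<omega> by (auto simp: in_solution_set_iff excess_lookup_restricted_point h divide_le_0_iff)
  hence "excess n \<pi> h \<le> 0"
    using \<pi> unfolding same by (auto simp: in_solution_set_iff excess_lookup_restricted_point)
  thus ?thesis
    using \<omega> by (simp add: h divide_le_0_iff)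
qed

subsection \<open>Linearization\<close>

lemma linearize_superset:
  assumes "finite K" "Poly_Mapping.keys p \<subseteq> K"
  shows "linearize w p = (\<Sum>m\<in>K. Poly_Mapping.lookup p m * w (Poly_Mapping.keys m))"
  unfolding linearize_def using assms by (intro sum.mono_neutral_left) (auto simp: in_keys_iff)

lemma linearize_add: "linearize w (p + q) = linearize w p + linearize w q"
proof -
  let ?K = "Poly_Mapping.keys p \<union> Poly_Mapping.keys q"
  have "linearize w (p + q) = (\<Sum>m\<in>?K. Poly_Mapping.lookup (p + q) m * w (Poly_Mapping.keys m))"
    by (intro linearize_superset keys_add) auto
  thus ?thesis
    using linearize_superset[of ?K p w] linearize_superset[of ?K q w]
    by (simp add: lookup_add distrib_right sum.distrib)
qed

lemma linearize_diff: "linearize w (p - q) = linearize w p - linearize w q"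
  using linearize_add[of w "p - q" q] by simp

lemma linearize_zero [simp]: "linearize w 0 = 0"
  by (simp add: linearize_def)

lemma linearize_sum: "linearize w (\<Sum>x\<in>X. p x) = (\<Sum>x\<in>X. linearize w (p x))"
  by (induction X rule: infinite_finite_induct) (simp_all add: linearize_add)

lemma linearize_single [simp]: "linearize w (Poly_Mapping.single m c) = c * w (Poly_Mapping.keys m)"
  by (simp add: linearize_def)

lemma sum_single_lookup: "(\<Sum>m\<in>Poly_Mapping.keys p. Poly_Mapping.single m (Poly_Mapping.lookup p m)) = p"
proof (rule poly_mapping_eqI)
  fix k
  have "(\<Sum>m\<in>Poly_Mapping.keys p. Poly_Mapping.lookup p m when m = k) = Poly_Mapping.lookup p k"
    by (auto simp: when_def in_keys_iff)
  thus "Poly_Mapping.lookup (\<Sum>m\<in>Poly_Mapping.keys p. Poly_Mapping.single m (Poly_Mapping.lookup p m)) k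
      = Poly_Mapping.lookup p k"
    by (simp add: lookup_sum lookup_single)
qed

lemma prod_insert_idem:
  fixes u :: "'a \<Rightarrow> real"
  assumes "finite M" "u v * u v = u v"
  shows "prod u (insert v M) = prod u M * u v"
proof (cases "v \<in> M")
  case True
  thus ?thesis
    using assms prod.remove[of M v u] by (simp add: insert_absorb mult.commute mult.assoc[symmetric])
qed (use assms in simp)

text \<open>A monomial that already contains \<open>v\<close> keeps its set of variables when
  multiplied by \<open>v\<close>; this agrees with evaluation at \<open>u\<close> because
  \<open>u v\<close> is idempotent.\<close>

lemma linearize_mult_var:
  assumes "u v * u v = u v"
  shows "linearize (prod u) (p * var_poly v) = linearize (prod u) p * u v"
proof -
  have keys: "Poly_Mapping.keys (m + Poly_Mapping.single v 1) = insert v (Poly_Mapping.keys m)"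
    for m :: "(var, nat) poly_mapping"
    by (auto simp: in_keys_iff lookup_add lookup_single when_def split: if_splits)
  have "p * var_poly v = (\<Sum>m\<in>Poly_Mapping.keys p.
      Poly_Mapping.single m (Poly_Mapping.lookup p m)) * var_poly v"
    by (simp only: sum_single_lookup)
  also have "\<dots> = (\<Sum>m\<in>Poly_Mapping.keys p.
      Poly_Mapping.single (m + Poly_Mapping.single v 1) (Poly_Mapping.lookup p m))"
    by (simp add: sum_distrib_right var_poly_def mult_single)
  finally have "linearize (prod u) (p * var_poly v)
      = (\<Sum>m\<in>Poly_Mapping.keys p. Poly_Mapping.lookup p m * prod u (insert v (Poly_Mapping.keys m)))"
    by (simp only: linearize_sum linearize_single keys)
  also have "\<dots> = linearize (prod u) p * u v"
    using assms by (simp add: prod_insert_idem linearize_def sum_distrib_right mult.assoc)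
  finally show ?thesis .
qed

lemma linearize_mult_prod_var:
  assumes "\<And>i. u (Yvar i) * u (Yvar i) = u (Yvar i)"
  shows "linearize (prod u) (p * (\<Prod>i\<in>A. var_poly (Yvar i))) = linearize (prod u) p * (\<Prod>i\<in>A. u (Yvar i))"
proof (induction A rule: infinite_finite_induct)
  case (insert i A)
  have "p * (\<Prod>i\<in>insert i A. var_poly (Yvar i)) = (p * (\<Prod>i\<in>A. var_poly (Yvar i))) * var_poly (Yvar i)"
    using insert.hyps by (simp add: mult_ac)
  hence "linearize (prod u) (p * (\<Prod>i\<in>insert i A. var_poly (Yvar i)))
      = linearize (prod u) p * (\<Prod>i\<in>A. u (Yvar i)) * u (Yvar i)"
    by (simp only: linearize_mult_var assms insert.IH)
  thus ?case
    using insert.hyps by (simp add: mult_ac)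
qed simp_all

lemma linearize_mult_prod_compl:
  assumes "\<And>i. u (Yvar i) * u (Yvar i) = u (Yvar i)"
  shows "linearize (prod u) (p * (\<Prod>i\<in>A. 1 - var_poly (Yvar i)))
       = linearize (prod u) p * (\<Prod>i\<in>A. 1 - u (Yvar i))"
proof (induction A rule: infinite_finite_induct)
  case (insert i A)
  let ?q = "p * (\<Prod>i\<in>A. 1 - var_poly (Yvar i))"
  have "p * (\<Prod>i\<in>insert i A. 1 - var_poly (Yvar i)) = ?q - ?q * var_poly (Yvar i)"
    using insert.hyps by (simp add: algebra_simps)
  hence "linearize (prod u) (p * (\<Prod>i\<in>insert i A. 1 - var_poly (Yvar i)))
      = linearize (prod u) p * (\<Prod>i\<in>A. 1 - u (Yvar i)) * (1 - u (Yvar i))"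
    by (simp only: linearize_mult_var linearize_diff assms insert.IH right_diff_distrib mult_1_right)
  thus ?case
    using insert.hyps by (simp add: mult_ac)
qed simp_all

text \<open>At a point with 0/1 openings linearization is evaluation. Assignments may be fractional,
  since they occur only in the constraint itself, to the first power.\<close>

lemma linearize_lifted_constraint:
  assumes "\<And>i. u (Yvar i) * u (Yvar i) = u (Yvar i)"
  shows "linearize (prod u) (lifted_constraint n \<pi> A W)
       = excess n \<pi> u * (\<Prod>i\<in>A - W. u (Yvar i)) * (\<Prod>i\<in>W. 1 - u (Yvar i))"
proof -
  have "linearize (prod u) ((\<Sum>v\<in>variables n. const_poly (fst \<pi> v) * var_poly v) - const_poly (snd \<pi>))
      = excess n \<pi> u"
    by (simp add: linearize_diff linearize_sum const_poly_def var_poly_def mult_single excess_def)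
  thus ?thesis
    by (simp add: lifted_constraint_def linearize_mult_prod_compl linearize_mult_prod_var assms)
qed

lemma linearize_combination:
  "linearize (\<lambda>M. c * f M + d * (\<Sum>s\<in>S. h s M)) p = c * linearize f p + d * (\<Sum>s\<in>S. linearize (h s) p)"
proof -
  let ?K = "Poly_Mapping.keys p" and ?c = "Poly_Mapping.lookup p"
  have "linearize (\<lambda>M. c * f M + d * (\<Sum>s\<in>S. h s M)) p
      = c * linearize f p + d * (\<Sum>m\<in>?K. \<Sum>s\<in>S. ?c m * h s (Poly_Mapping.keys m))"
    by (simp add: linearize_def distrib_left sum.distrib sum_distrib_left mult.left_commute)
  also have "(\<Sum>m\<in>?K. \<Sum>s\<in>S. ?c m * h s (Poly_Mapping.keys m))
      = (\<Sum>s\<in>S. \<Sum>m\<in>?K. ?c m * h s (Poly_Mapping.keys m))"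
    by (rule sum.swap)
  finally show ?thesis
    by (simp only: linearize_def)
qed

section \<open>The mean point and its moments\<close>

definition gap_point :: "nat \<Rightarrow> nat set \<Rightarrow> nat set \<Rightarrow> point" where
  "gap_point n T R = restricted_point n (\<lambda>v. (1 - 1 / real n) * overfull n T R v
     + 1 / (real n)\<^sup>2 * (\<Sum>s\<in>facilities n - T - R. relieved n T R s v))"

lemma card_rest:
  assumes "(T, R) \<in> splits (facilities n) n"
  shows "card (facilities n - T - R) = n"
proof -
  have TR: "T \<subseteq> facilities n" "card T = n" "R \<subseteq> facilities n - T" "card R = n"
    using assms by (auto simp: splits_def)
  have "finite T" "finite R"
    using TR(1,3) by (auto intro: finite_subset)
  thus ?thesis
    using TR by (simp add: card_Diff_subset)
qed

lemma overfull_Yvar [simp]: "overfull n T R (Yvar i) = of_bool (i \<in> T \<union> R)"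
  and relieved_Yvar [simp]: "relieved n T R s (Yvar i) = of_bool (i \<in> insert s (T \<union> R))"
  by (simp_all add: overfull_def relieved_def)

lemma prod_of_bool: "finite A \<Longrightarrow> (\<Prod>i\<in>A. of_bool (P i)) = (of_bool (\<forall>i\<in>A. P i) :: real)"
  by (induction A rule: finite_induct) auto

text \<open>Conditioning on the facilities of \<open>A - W\<close> being open and those of \<open>W\<close> being closed either
  leaves only relieved points or merely removes \<open>W\<close> from the facilities that offer relief.\<close>

lemma gap_point_in_sherali_adams:
  assumes n: "n \<ge> 2" and TR: "(T, R) \<in> splits (facilities n) n"
    and valid: "\<And>\<pi>. \<pi> \<in> D \<Longrightarrow> valid_inequality n \<pi>"
    and cond: "\<And>\<pi> S. \<pi> \<in> D \<Longrightarrow> S \<subseteq> facilities n - T - R \<Longrightarrow> n \<le> 2 * card S \<Longrightarrow>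
      conditional_excess n \<pi> T R S \<le> 0"
    and t: "2 * t \<le> n"
  shows "gap_point n T R \<in> sherali_adams n t D"
proof -
  let ?F = "facilities n"
  define S where "S = ?F - T - R"
  have T: "T \<subseteq> ?F" "card T = n"
    using TR by (auto simp: splits_def)
  have S: "finite S" "card S = n" "S \<inter> (T \<union> R) = {}"
    using card_rest[OF TR] by (auto simp: S_def)
  let ?u = "overfull n T R" and ?r = "relieved n T R"
  \<comment> \<open>Expected products under the distribution with mean \<open>gap_point\<close>. Its
    weights sum to 1 because \<open>card S = n\<close>, whence \<open>w {} = 1\<close>.\<close>
  define w where "w M = (1 - 1 / real n) * prod ?u M + 1 / (real n)\<^sup>2 * (\<Sum>s\<in>S. prod (?r s) M)" for M
  have w_empty: "w {} = 1"
    using n S by (simp add: w_def power2_eq_square)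
  have w_single: "w {v} = Poly_Mapping.lookup (gap_point n T R) v" if "v \<in> variables n" for v
    using that by (simp add: w_def gap_point_def lookup_restricted_point S_def)
  have lifted: "linearize w (lifted_constraint n \<pi> A W) \<le> 0"
    if \<pi>: "\<pi> \<in> D" and A: "A \<subseteq> ?F" "card A \<le> t" "W \<subseteq> A" for \<pi> A W
  proof -
    have fin: "finite A" "finite W"
      using A finite_subset[of A ?F] by (auto intro: finite_subset)
    \<comment> \<open>The value of the multipliers at a point with open set \<open>V\<close>: the
      indicator of the event conditioned on.\<close>
    define \<rho> where "\<rho> V = (of_bool (A - W \<subseteq> V \<and> W \<inter> V = {}) :: real)" for V
    have select: "(\<Prod>i\<in>A - W. of_bool (i \<in> V)) * (\<Prod>i\<in>W. 1 - of_bool (i \<in> V)) = \<rho> V" for V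
    proof -
      have "(\<Prod>i\<in>W. 1 - of_bool (i \<in> V)) = (\<Prod>i\<in>W. of_bool (i \<notin> V) :: real)"
        by (intro prod.cong) auto
      moreover have "(A - W \<subseteq> V \<and> W \<inter> V = {}) \<longleftrightarrow> (\<forall>i\<in>A - W. i \<in> V) \<and> (\<forall>i\<in>W. i \<notin> V)"
        by blast
      ultimately show ?thesis
        unfolding \<rho>_def using fin by (simp only: prod_of_bool finite_Diff of_bool_conj)
    qed
    have "linearize w (lifted_constraint n \<pi> A W)
        = (1 - 1 / real n) * linearize (prod ?u) (lifted_constraint n \<pi> A W)
          + 1 / (real n)\<^sup>2 * (\<Sum>s\<in>S. linearize (prod (?r s)) (lifted_constraint n \<pi> A W))"
      unfolding w_def by (rule linearize_combination)
    also have "linearize (prod ?u) (lifted_constraint n \<pi> A W) = excess n \<pi> ?u * \<rho> (T \<union> R)"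
      by (subst linearize_lifted_constraint) (simp_all only: overfull_Yvar mult.assoc select, simp)
    also have "(\<Sum>s\<in>S. linearize (prod (?r s)) (lifted_constraint n \<pi> A W))
        = (\<Sum>s\<in>S. excess n \<pi> (?r s) * \<rho> (insert s (T \<union> R)))"
      by (intro sum.cong refl, subst linearize_lifted_constraint)
        (simp_all only: relieved_Yvar mult.assoc select, simp)
    finally have lin: "linearize w (lifted_constraint n \<pi> A W)
        = (1 - 1 / real n) * (excess n \<pi> ?u * \<rho> (T \<union> R))
          + 1 / (real n)\<^sup>2 * (\<Sum>s\<in>S. excess n \<pi> (?r s) * \<rho> (insert s (T \<union> R)))" .
    have r_le: "excess n \<pi> (?r s) \<le> 0" if "s \<in> S" for s
      using that T by (intro excess_relieved_le n valid \<pi>) (auto simp: S_def)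
    show ?thesis
    proof (cases "A - W \<subseteq> T \<union> R \<and> W \<inter> (T \<union> R) = {}")
      case False
      hence "\<rho> (T \<union> R) = 0" by (auto simp: \<rho>_def)
      moreover have "(\<Sum>s\<in>S. excess n \<pi> (?r s) * \<rho> (insert s (T \<union> R))) \<le> 0"
        by (intro sum_nonpos mult_nonpos_nonneg r_le) (auto simp: \<rho>_def)
      ultimately show ?thesis
        unfolding lin by (simp add: divide_nonpos_nonneg)
    next
      case True
      hence u: "\<rho> (T \<union> R) = 1" by (simp add: \<rho>_def)
      have "\<rho> (insert s (T \<union> R)) = of_bool (s \<notin> W)" if "s \<in> S" for s
        using True by (auto simp: \<rho>_def)
      hence "(\<Sum>s\<in>S. excess n \<pi> (?r s) * \<rho> (insert s (T \<union> R))) = (\<Sum>s\<in>S - W. excess n \<pi> (?r s))"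
        using S(1) by (intro sum.mono_neutral_cong_right) auto
      hence "linearize w (lifted_constraint n \<pi> A W) = conditional_excess n \<pi> T R (S - W)"
        unfolding lin u by (simp add: conditional_excess_def)
      also have "\<dots> \<le> 0"
      proof (rule cond[OF \<pi>])
        \<comment> \<open>At most \<open>t \<le> n / 2\<close> of the \<open>n\<close> facilities of
          \<open>S\<close> are removed, so at least half remain.\<close>
        have "card W \<le> card A" using fin A by (intro card_mono)
        moreover have "card S - card W \<le> card (S - W)"
          using fin by (intro diff_card_le_card_Diff)
        ultimately show "n \<le> 2 * card (S - W)"
          using S(2) t A(2) by linarith
      qed (auto simp: S_def)
      finally show ?thesis .
    qed
  qed
  have "gap_point n T R \<in> space_of n"
    by (simp add: gap_point_def)
  thus ?thesis
    unfolding sherali_adams_def using w_empty w_single lifted by blast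
qed

subsection \<open>The objective\<close>

definition opening_cost :: "nat \<Rightarrow> nat set \<Rightarrow> nat set \<Rightarrow> nat \<Rightarrow> real" where
  "opening_cost n T R i = of_bool (i \<notin> T \<union> R)"

definition assignment_cost :: "nat \<Rightarrow> nat set \<Rightarrow> nat \<Rightarrow> nat \<Rightarrow> real" where
  "assignment_cost n R i j = of_bool (i \<in> R) * 2 powr (real (n ^ 2))"

text \<open>Assignment costs depend on the facility only, so \<open>c i j\<close> equals the term
  \<open>c i j'\<close> on the right of the triangle condition.\<close>

lemma admissible_gap_objective:
  "admissible_objective n (opening_cost n T R) (assignment_cost n R)"
  by (auto simp: admissible_objective_def opening_cost_def assignment_cost_def)

text \<open>\<open>R\<close> is empty in every point of the distribution, so only the
  \<open>n\<close> facilities of \<open>S\<close> cost anything, each being open to the extent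
  \<open>1 / n ^ 2\<close>.\<close>

lemma cost_gap_point:
  assumes n: "n \<ge> 1" and TR: "(T, R) \<in> splits (facilities n) n"
  shows "cost n (opening_cost n T R) (assignment_cost n R) (gap_point n T R) = 1 / real n"
proof -
  let ?F = "facilities n"
  define S where "S = ?F - T - R"
  have disj: "R \<inter> T = {}"
    using TR by (auto simp: splits_def)
  have S: "finite S" "card S = n"
    using card_rest[OF TR] by (auto simp: S_def)
  have y: "yval (gap_point n T R) i = 1 / (real n)\<^sup>2" if "i \<in> S" for i
  proof -
    have i: "i \<in> ?F" "i \<notin> T" "i \<notin> R" using that by (auto simp: S_def)
    have "(\<Sum>s\<in>S. relieved n T R s (Yvar i)) = (\<Sum>s\<in>S. if s = i then 1 else 0)"
      using i by (intro sum.cong) auto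
    also have "\<dots> = 1" using that S(1) by simp
    finally show ?thesis
      using i by (simp add: gap_point_def lookup_restricted_point S_def)
  qed
  have "(\<Sum>i\<in>?F. opening_cost n T R i * yval (gap_point n T R) i) = (\<Sum>i\<in>S. 1 / (real n)\<^sup>2)"
    using y by (intro sum.mono_neutral_cong_right) (auto simp: opening_cost_def S_def)
  also have "\<dots> = 1 / real n"
    using S n by (simp add: power2_eq_square)
  finally have open_cost: "(\<Sum>i\<in>?F. opening_cost n T R i * yval (gap_point n T R) i) = 1 / real n" .
  have "assignment_cost n R i j * xval (gap_point n T R) i j = 0" for i j
  proof (cases "i \<in> R")
    case True
    hence "i \<notin> T" using disj by auto
    moreover have "(\<Sum>s\<in>S. relieved n T R s (Xvar i j)) = 0"
      using True \<open>i \<notin> T\<close> by (intro sum.neutral) (auto simp: relieved_def S_def)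
    ultimately show ?thesis
      by (simp add: gap_point_def lookup_restricted_point overfull_def S_def)
  qed (simp add: assignment_cost_def)
  thus ?thesis
    by (simp only: cost_def open_cost sum.neutral_const add_0_right)
qed

text \<open>Either a facility outside \<open>T \<union> R\<close> is opened at cost 1, or
  \<open>R\<close> must serve the \<open>2 powr (- n ^ 2)\<close> units that exceed the capacity of
  \<open>T\<close>, and the unit price on \<open>R\<close> is the reciprocal.\<close>

lemma integral_cost_ge_1:
  assumes n: "n \<ge> 1" and TR: "(T, R) \<in> splits (facilities n) n"
    and z: "z \<in> mixed_integer_solutions n"
  shows "cost n (opening_cost n T R) (assignment_cost n R) z \<ge> 1"
proof -
  let ?F = "facilities n" and ?C = "clients n"
  have T: "T \<subseteq> ?F" "card T = n" and R: "R \<subseteq> ?F - T"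
    using TR by (auto simp: splits_def)
  have y: "\<And>i. i \<in> ?F \<Longrightarrow> yval z i \<in> {0, 1}"
    and total: "\<And>j. j \<in> ?C \<Longrightarrow> (\<Sum>i\<in>?F. xval z i j) = 1"
    and x: "\<And>i j. i \<in> ?F \<Longrightarrow> j \<in> ?C \<Longrightarrow> 0 \<le> xval z i j \<and> xval z i j \<le> yval z i"
    and cap: "\<And>i. i \<in> ?F \<Longrightarrow> (\<Sum>j\<in>?C. xval z i j) \<le> capacity n * yval z i"
    using z by (auto simp: mixed_integer_solutions_def mixed_integral_def)
  define load where "load i = (\<Sum>j\<in>?C. xval z i j)" for i
  have load_nonneg: "0 \<le> load i" if "i \<in> ?F" for i
    unfolding load_def using x that by (intro sum_nonneg) auto
  let ?L = "2 powr (real (n ^ 2))"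
  have cost_eq: "cost n (opening_cost n T R) (assignment_cost n R) z
      = (\<Sum>i\<in>?F. of_bool (i \<notin> T \<union> R) * yval z i) + ?L * (\<Sum>i\<in>?F. of_bool (i \<in> R) * load i)"
    unfolding cost_def opening_cost_def assignment_cost_def load_def sum_distrib_left
    by (simp only: mult.assoc mult.left_commute)
  have y_nonneg: "0 \<le> of_bool (i \<notin> T \<union> R) * yval z i" if "i \<in> ?F" for i
    using y[OF that] by auto
  have R_nonneg: "0 \<le> (\<Sum>i\<in>?F. of_bool (i \<in> R) * load i)"
    using load_nonneg by (intro sum_nonneg mult_nonneg_nonneg) auto
  show ?thesis
  proof (cases "\<exists>i\<in>?F - T - R. yval z i = 1")
    case True
    then obtain i where i: "i \<in> ?F" "i \<notin> T \<union> R" "yval z i = 1" by blast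
    have "1 = of_bool (i \<notin> T \<union> R) * yval z i" using i by simp
    also have "\<dots> \<le> (\<Sum>i\<in>?F. of_bool (i \<notin> T \<union> R) * yval z i)"
      using y_nonneg i(1) by (intro member_le_sum) auto
    finally show ?thesis
      unfolding cost_eq using R_nonneg by (simp add: add_increasing2)
  next
    case False
    have no_load: "load i = 0" if "i \<in> ?F" "i \<notin> T" "i \<notin> R" for i
    proof -
      have "yval z i = 0" using False that y[of i] by auto
      thus ?thesis using cap[OF that(1)] load_nonneg[OF that(1)] by (simp add: load_def)
    qed
    \<comment> \<open>The sign matters for closed facilities, whose load bound is 0 instead of the
      capacity.\<close>
    have "capacity n \<ge> 0"
    proof -
      have "2 powr (- real (n ^ 2)) \<le> (2::real) powr 0" by (intro powr_mono) auto
      also have "\<dots> \<le> real (n ^ 4 + 1)" by simp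
      finally show ?thesis by (simp only: capacity_def) (intro divide_nonneg_nonneg, auto)
    qed
    hence load_le: "load i \<le> capacity n" if "i \<in> ?F" for i
      using cap[OF that] y[OF that] by (auto simp: load_def)
    have "(\<Sum>i\<in>?F. load i) = (\<Sum>j\<in>?C. \<Sum>i\<in>?F. xval z i j)"
      unfolding load_def by (rule sum.swap)
    also have "\<dots> = real (n ^ 4 + 1)"
      using total by simp
    finally have "real (n ^ 4 + 1) = (\<Sum>i\<in>?F. load i)" ..
    also have "\<dots> = (\<Sum>i\<in>?F. of_bool (i \<in> T) * load i + of_bool (i \<in> R) * load i)"
      using no_load R by (intro sum.cong refl) auto
    also have "\<dots> \<le> (\<Sum>i\<in>?F. of_bool (i \<in> T) * capacity n + of_bool (i \<in> R) * load i)"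
      using load_le by (intro sum_mono add_right_mono mult_left_mono) auto
    also have "\<dots> = real n * capacity n + (\<Sum>i\<in>?F. of_bool (i \<in> R) * load i)"
      using T by (simp only: sum.distrib sum_of_bool_mult finite_facilities)
    finally have "2 powr (- real (n ^ 2)) \<le> (\<Sum>i\<in>?F. of_bool (i \<in> R) * load i)"
      using capacity_eq[OF n] by linarith
    hence "?L * 2 powr (- real (n ^ 2)) \<le> ?L * (\<Sum>i\<in>?F. of_bool (i \<in> R) * load i)"
      by (intro mult_left_mono) auto
    moreover have "?L * 2 powr (- real (n ^ 2)) = 1"
      by (simp only: powr_add[symmetric]) simp
    moreover have "0 \<le> (\<Sum>i\<in>?F. of_bool (i \<notin> T \<union> R) * yval z i)"
      using y_nonneg by (intro sum_nonneg)
    ultimately show ?thesis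
      unfolding cost_eq by linarith
  qed
qed

lemma integrality_gap_ge:
  assumes n: "n \<ge> 1" and TR: "(T, R) \<in> splits (facilities n) n" and S: "gap_point n T R \<in> S"
  shows "integrality_gap n S \<ge> ereal (real n)"
proof -
  let ?f = "opening_cost n T R" and ?c = "assignment_cost n R"
  define a where "a = optimal_cost n ?f ?c (mixed_integer_solutions n)"
  define b where "b = max 0 (optimal_cost n ?f ?c S)"
  have a: "1 \<le> a"
    unfolding a_def optimal_cost_def using integral_cost_ge_1[OF n TR]
    by (intro INF_greatest) (simp add: one_ereal_def)
  have "optimal_cost n ?f ?c S \<le> ereal (1 / real n)"
    unfolding optimal_cost_def cost_gap_point[OF n TR, symmetric] by (intro INF_lower S)
  hence b: "0 \<le> b" "b \<le> ereal (1 / real n)"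
    by (auto simp: b_def zero_ereal_def)
  have "ereal (real n) \<le> a / b"
  proof (cases "b = 0")
    \<comment> \<open>A relaxation cost cut off at 0 makes the ratio infinite, as the numerator is
      at least 1.\<close>
    case True
    hence "a / b = \<infinity>" using a by (cases a) (auto simp: divide_ereal_def one_ereal_def)
    thus ?thesis by simp
  next
    case False
    then obtain b' where b': "b = ereal b'" "b' > 0"
      using b by (cases b) (auto simp: zero_ereal_def less_le)
    have "b' \<le> 1 / real n" using b b' by simp
    hence "real n * b' \<le> 1" using n by (simp add: field_simps)
    hence "ereal (real n) * b \<le> 1" by (simp add: b' one_ereal_def)
    hence "ereal (real n) * b \<le> a" using a by (rule order_trans)
    thus ?thesis using b' by (simp add: ereal_le_divide_pos mult.commute)
  qed
  also have "a / b \<le> integrality_gap n S"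
    unfolding integrality_gap_def a_def b_def
    by (rule SUP_upper2[of "(?f, ?c)"]) (auto simp: admissible_gap_objective)
  finally show ?thesis .
qed

section \<open>From the size bound to the gap\<close>

lemma valid_if_relaxation:
  assumes "linear_relaxation n P" "halfspace_description n D P" "\<pi> \<in> D"
  shows "valid_inequality n \<pi>"
  unfolding valid_inequality_def
proof
  fix z assume "z \<in> mixed_integer_solutions n"
  hence "z \<in> cfl_polytope n"
    unfolding cfl_polytope_def by (rule hull_inc)
  hence "z \<in> solution_set n D"
    using assms(1,2) by (auto simp: linear_relaxation_def halfspace_description_def)
  thus "excess n \<pi> (Poly_Mapping.lookup z) \<le> 0"
    using assms(3) by (auto simp: in_solution_set_iff)
qed

theorem theorem5p2:
  fixes P :: "nat \<Rightarrow> point set" and D :: "nat \<Rightarrow> inequality set" and g :: "nat \<Rightarrow> real"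
  assumes relaxation: "\<And>n. n \<ge> 1 \<Longrightarrow> linear_relaxation n (P n)"
    and description: "\<And>n. n \<ge> 1 \<Longrightarrow> halfspace_description n (D n) (P n)"
    and subexponential: "g \<in> o(\<lambda>n. real n)"
    and size: "\<And>n. n \<ge> 1 \<Longrightarrow> real (relaxation_size n (P n)) \<le> 2 powr g n"
  shows "\<exists>c>0. \<exists>\<delta>>0. \<forall>\<^sub>F n in sequentially. \<forall>t::nat. 1 \<le> t \<and> real t \<le> c * real n \<longrightarrow>
           integrality_gap n (sherali_adams n t (D n)) \<ge> ereal (\<delta> * real n)"
proof -
  \<comment> \<open>Any rate below the binary logarithm of \<open>3 / 2\<close> would do;
    \<open>1 / 4\<close> allows a comparison of fourth powers.\<close>
  have "\<forall>\<^sub>F n in sequentially. norm (g n) \<le> 1 / 4 * norm (real n)"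
    using subexponential by (rule landau_o.smallD) simp
  hence main: "\<forall>\<^sub>F n in sequentially. \<forall>t::nat. 1 \<le> t \<and> real t \<le> 1 / 2 * real n \<longrightarrow>
    integrality_gap n (sherali_adams n t (D n)) \<ge> ereal (1 * real n)"
    using eventually_ge_at_top[of "8::nat"]
  proof eventually_elim
    case (elim n)
    have n: "n \<ge> 1" "n \<ge> 2" using elim(2) by linarith+
    have "norm (g n) \<le> 1 / 4 * norm (real n)" by (rule elim(1))
    hence gn: "g n \<le> real n / 4" using abs_ge_self[of "g n"] by (simp only: real_norm_def abs_of_nat)
    \<comment> \<open>Counting is applied to a smallest description, since \<open>D n\<close> itself
      may be much larger.\<close>
    obtain D' where D': "halfspace_description n D' (P n)" "card D' = relaxation_size n (P n)"
    proof -
      have "\<exists>k D'. halfspace_description n D' (P n) \<and> card D' = k"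
        using description[OF n(1)] by blast
      hence "\<exists>D'. halfspace_description n D' (P n) \<and> card D' = relaxation_size n (P n)"
        unfolding relaxation_size_def by (rule LeastI_ex)
      thus ?thesis using that by blast
    qed
    have few: "2 * real (card D') < (3 / 2) ^ n"
    proof -
      \<comment> \<open>In fourth powers: \<open>16 * 2 ^ n < 5 ^ n\<close> for
        \<open>n \<ge> 8\<close>, and \<open>5 < 81 / 16 = (3 / 2) ^ 4\<close>.\<close>
      have "(2 * real (card D')) ^ 4 \<le> (2 * 2 powr (real n / 4)) ^ 4"
      proof (intro power_mono mult_left_mono)
        have "real (card D') \<le> 2 powr g n" using size[OF n(1)] D'(2) by simp
        also have "\<dots> \<le> 2 powr (real n / 4)" using gn by (intro powr_mono) auto
        finally show "real (card D') \<le> 2 powr (real n / 4)" .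
      qed auto
      also have "\<dots> = 16 * 2 ^ n"
      proof -
        have "(2 powr (real n / 4)) ^ 4 = (2::real) powr (real n / 4 * 4)"
          by (subst powr_power) auto
        also have "\<dots> = 2 ^ n" by (simp add: powr_realpow)
        finally show ?thesis by (simp add: power_mult_distrib)
      qed
      also have "\<dots> < (5 / 2) ^ n * 2 ^ n"
      proof -
        have "(16::real) < (5 / 2) ^ 8" by (simp add: power_divide)
        also have "\<dots> \<le> (5 / 2) ^ n" using elim by (intro power_increasing) auto
        finally show ?thesis by (intro mult_strict_right_mono) auto
      qed
      also have "\<dots> = 5 ^ n"
        by (subst power_mult_distrib[symmetric]) simp
      also have "(5::real) ^ n \<le> ((3 / 2) ^ 4) ^ n"
        by (intro power_mono) (auto simp: power_divide)
      also have "\<dots> = ((3 / 2) ^ n) ^ 4"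
        by (simp only: power_mult[symmetric] mult.commute)
      finally show ?thesis
        by (rule power_less_imp_less_base) simp
    qed
    have same: "solution_set n D' = solution_set n (D n)" and fin: "finite D'"
      using D'(1) description[OF n(1)] by (auto simp: halfspace_description_def)
    have "valid_inequality n \<pi>" if "\<pi> \<in> D'" for \<pi>
      by (rule valid_if_relaxation[OF relaxation[OF n(1)] D'(1) that])
    from exists_unseparated_partition[OF n(2) fin few this]
    obtain T R where TR: "(T, R) \<in> splits (facilities n) n"
      and partition: "\<forall>\<pi>\<in>D'. \<forall>S. S \<subseteq> facilities n - T - R \<longrightarrow> n \<le> 2 * card S \<longrightarrow>
        conditional_excess n \<pi> T R S \<le> 0"
      by blast
    have cond: "conditional_excess n \<pi> T R S \<le> 0"
      if "\<pi> \<in> D'" "S \<subseteq> facilities n - T - R" "n \<le> 2 * card S" for \<pi> S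
      using partition that by simp
    have "gap_point n T R \<in> sherali_adams n t (D n)" if "2 * t \<le> n" for t
    proof (rule gap_point_in_sherali_adams[OF n(2) TR _ _ that])
      show "valid_inequality n \<pi>" if "\<pi> \<in> D n" for \<pi>
        by (rule valid_if_relaxation[OF relaxation[OF n(1)] description[OF n(1)] that])
      show "conditional_excess n \<pi> T R S \<le> 0"
        if "\<pi> \<in> D n" "S \<subseteq> facilities n - T - R" "n \<le> 2 * card S" for \<pi> S
        by (rule conditional_excess_le_transfer[OF n(2) same that(1)]) (rule cond[OF _ that(2,3)])
    qed
    hence gap: "integrality_gap n (sherali_adams n t (D n)) \<ge> ereal (real n)" if "2 * t \<le> n" for t
      using that by (intro integrality_gap_ge[OF n(1) TR])
    show ?case
    proof (intro allI impI)
      fix t :: nat assume "1 \<le> t \<and> real t \<le> 1 / 2 * real n"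
      hence "2 * t \<le> n" by linarith
      thus "integrality_gap n (sherali_adams n t (D n)) \<ge> ereal (1 * real n)"
        unfolding mult_1 by (rule gap)
    qed
  qed
  show ?thesis
  proof (rule exI[of _ "1 / 2"], rule conjI)
    show "\<exists>\<delta>>0. \<forall>\<^sub>F n in sequentially. \<forall>t::nat. 1 \<le> t \<and> real t \<le> 1 / 2 * real n \<longrightarrow>
      integrality_gap n (sherali_adams n t (D n)) \<ge> ereal (\<delta> * real n)"
      by (rule exI[of _ 1], rule conjI) (simp, rule main)
  qed simp
qed

end
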